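(* Let $\mathcal{X}$ be $[0,1]^d$ or $\mathbb{R}^d$, let $T>0$, let $\lambda\ge 0$, and let $p_0$ be a probability density on $\mathcal{X}$. Let $G$ be a generator with latent variable $\boldsymbol{z}\sim p_z$, and let $q(\boldsymbol{y})$, $\boldsymbol{y}\in\mathcal{X}$, be the probability density of the generated sample $\boldsymbol{y}=G(\boldsymbol{z})$. Suppose $\|p_0\|_\infty<\infty$ and $\frac{p_0}{p_0+q}\in\mathcal{U}_\delta$ for a $\delta\in[0,1/2)$. Let $s_t$, $t\in[0,T]$, be a strictly positive scaling function with $s_0=1$, and let $\pi$ be a probability distribution on $[0,T]$ with density $\pi(t)>0$. Then the maximization problem $$\max_{\widetilde{D}(\cdot,t)\in\mathcal{U}_0,\ 0\le t\le T}\ \mathbb{E}_{t\sim\pi}\Big[\mathbb{E}_{\boldsymbol{x}\sim p_0}[\log\widetilde{D}(s_t\boldsymbol{x},t)]+\mathbb{E}_{\boldsymbol{z}\sim p_z}[\log(1-\widetilde{D}(s_tG(\boldsymbol{z}),t))]-\lambda\,\mathbb{V}_{\boldsymbol{x}\sim p_0}[\widetilde{D}(s_t\boldsymbol{x},t)]\Big]$$ has a unique optimal solution $\{\widetilde{D}(\cdot,t)\}_{t\in[0,T]}\subset\mathcal{U}_0$. Furthermore, the optimal discriminator satisfies $\widetilde{D}(s_t\boldsymbol{x},t)=\widetilde{D}(\boldsymbol{x},0)$ for $(\boldsymbol{x},t)\in\mathcal{X}\times[0,T]$.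
   Context: All densities on $\mathcal{X}$ are with respect to Lebesgue measure and are assumed strictly positive on their domain. $\|f\|_\infty$ is the (essential) supremum of $|f|$. For $\delta\in[0,1/2)$, $\mathcal{U}_\delta=\{f\in L^\infty : \delta<\inf f,\ \sup f<1-\delta\}$. For each $t$, the discriminator $\widetilde{D}(\cdot,t)$ is regarded as a function on $s_t\mathcal{X}=\{s_t\boldsymbol{x}:\boldsymbol{x}\in\mathcal{X}\}$, the domain of the scaled data. $\mathbb{V}_{\boldsymbol{x}\sim p_0}[f(\boldsymbol{x})]$ is the variance of $f(\boldsymbol{x})$ under $\boldsymbol{x}\sim p_0$. Differences on sets of measure zero are ignored: uniqueness and the final identity are understood up to sets of measure zero. *)

theory Defs
  imports "HOL-Probability.Probability"
begin

text \<open>Functions on a domain \<open>S\<close> are HOL functions of which only the values on \<open>S\<close> matter;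
  measurability is Borel measurability, and every class in \<open>L\<^sup>\<infinity>\<close> has a Borel representative.\<close>

abbreviation lborel_on :: "'a::euclidean_space set \<Rightarrow> 'a measure" where
  "lborel_on S \<equiv> restrict_space lborel S"

definition pos_prob_density :: "'a measure \<Rightarrow> ('a \<Rightarrow> real) \<Rightarrow> bool" where
  "pos_prob_density M p \<longleftrightarrow>
     p \<in> borel_measurable M \<and> (\<forall>x\<in>space M. 0 < p x) \<and> prob_space (density M (\<lambda>x. ennreal (p x)))"

abbreviation prob_with :: "'a measure \<Rightarrow> ('a \<Rightarrow> real) \<Rightarrow> 'a measure" where
  "prob_with M p \<equiv> density M (\<lambda>x. ennreal (p x))"

definition Linf :: "'a measure \<Rightarrow> ('a \<Rightarrow> real) set" where
  "Linf M = {f \<in> borel_measurable M. esssup M (\<lambda>x. ereal \<bar>f x\<bar>) < \<infinity>}"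

definition essinf :: "'a measure \<Rightarrow> ('a \<Rightarrow> ereal) \<Rightarrow> ereal" where
  "essinf M f = - esssup M (\<lambda>x. - f x)"

definition U_class :: "'a measure \<Rightarrow> real \<Rightarrow> ('a \<Rightarrow> real) set" where
  "U_class M \<delta> = {f \<in> Linf M. ereal \<delta> < essinf M (\<lambda>x. ereal (f x)) \<and>
                                esssup M (\<lambda>x. ereal (f x)) < ereal (1 - \<delta>)}"

text \<open>Expectation with values in \<open>[-\<infinity>,\<infinity>]\<close>. The Bochner integral would assign 0 to a
  non-integrable function, which exceeds the values of the (nonpositive) objective below.\<close>

definition ext_expectation :: "'a measure \<Rightarrow> ('a \<Rightarrow> real) \<Rightarrow> ereal" where
  "ext_expectation M f =
     enn2ereal (\<integral>\<^sup>+ x. ennreal (f x) \<partial>M) - enn2ereal (\<integral>\<^sup>+ x. ennreal (- f x) \<partial>M)"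

text \<open>In the following, \<open>P\<close> is the data distribution, \<open>Z\<close> the latent distribution,
  \<open>R\<close> the distribution of \<open>t\<close> on \<open>[0,T]\<close>, and \<open>D y t\<close> the discriminator.\<close>

definition slice_objective ::
  "'a::real_vector measure \<Rightarrow> 'z measure \<Rightarrow> ('z \<Rightarrow> 'a) \<Rightarrow> real \<Rightarrow> (real \<Rightarrow> real) \<Rightarrow>
   ('a \<Rightarrow> real \<Rightarrow> real) \<Rightarrow> real \<Rightarrow> real" where
  "slice_objective P Z G lam s D t =
     prob_space.expectation P (\<lambda>x. ln (D (s t *\<^sub>R x) t))
     + prob_space.expectation Z (\<lambda>z. ln (1 - D (s t *\<^sub>R G z) t))
     - lam * prob_space.variance P (\<lambda>x. D (s t *\<^sub>R x) t)"

definition objective ::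
  "real measure \<Rightarrow> 'a::real_vector measure \<Rightarrow> 'z measure \<Rightarrow> ('z \<Rightarrow> 'a) \<Rightarrow> real \<Rightarrow>
   (real \<Rightarrow> real) \<Rightarrow> ('a \<Rightarrow> real \<Rightarrow> real) \<Rightarrow> ereal" where
  "objective R P Z G lam s D = ext_expectation R (slice_objective P Z G lam s D)"

text \<open>The measurability condition is what it takes for the expectation over \<open>t\<close> to be defined.
  It is implied by joint measurability of \<open>(x, t) \<mapsto> D (s t *\<^sub>R x) t\<close>, and it needs no
  measurability of the scaling \<open>s\<close>.\<close>

definition feasible ::
  "'a::euclidean_space set \<Rightarrow> real measure \<Rightarrow> 'a measure \<Rightarrow> 'z measure \<Rightarrow> ('z \<Rightarrow> 'a) \<Rightarrow> real \<Rightarrow>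
   (real \<Rightarrow> real) \<Rightarrow> ('a \<Rightarrow> real \<Rightarrow> real) \<Rightarrow> bool" where
  "feasible X R P Z G lam s D \<longleftrightarrow>
     (\<forall>t\<in>space R. (\<lambda>y. D y t) \<in> U_class (lborel_on ((*\<^sub>R) (s t) ` X)) 0) \<and>
     slice_objective P Z G lam s D \<in> borel_measurable R"

definition optimal ::
  "'a::euclidean_space set \<Rightarrow> real measure \<Rightarrow> 'a measure \<Rightarrow> 'z measure \<Rightarrow> ('z \<Rightarrow> 'a) \<Rightarrow> real \<Rightarrow>
   (real \<Rightarrow> real) \<Rightarrow> ('a \<Rightarrow> real \<Rightarrow> real) \<Rightarrow> bool" where
  "optimal X R P Z G lam s D \<longleftrightarrow>
     feasible X R P Z G lam s D \<and>
     (\<forall>D'. feasible X R P Z G lam s D' \<longrightarrow>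
        objective R P Z G lam s D' \<le> objective R P Z G lam s D)"

end

(* Write J(v) for the objective of a single time slice, and r = p0 / (p0 + q). The stationarity
   condition of J is r/u - (1-r)/(1-u) - 2 lam r (u - m) = 0 with m = E u. For a given m it has
   exactly one root u = u_m(x) in (0,1), which lies between r and m and depends continuously on m,
   so by the intermediate value theorem m = E u_m holds for some m in (0,1), and this u is bounded
   away from 0 and 1. With phi(y) = y - 1 - ln y, stationarity turns into the exact identity
     J(u) - J(v) = E_P phi(v/u) + E_Q phi((1-v)/(1-u)) + lam Var_P(v - u),
   so u is the unique maximizer. Rescaling by s_t identifies all slices with the slice t = 0. *)
theory Submission
  imports Defs
begin

subsection \<open>The stationarity equation\<close>

text \<open>With \<open>r = p / (p + q)\<close>, \<open>b = 2 * lam\<close> and \<open>a\<close> the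
  mean of u under P, this is the pointwise first variation of the slice objective, divided by
  \<open>p + q\<close>. The mean enters as a free number \<open>a\<close>, so each point of the
  domain gives a scalar equation; the coupling through the mean is restored in
  \<open>ex_payoff_stationary\<close>.\<close>

definition stationary :: "real \<Rightarrow> real \<Rightarrow> real \<Rightarrow> real \<Rightarrow> real" where
  "stationary b r a u = r / u - (1 - r) / (1 - u) - b * r * (u - a)"

lemma stationary_strict_antimono:
  assumes "0 < r" "r < 1" "0 \<le> b" "0 < u" "u < v" "v < 1"
  shows "stationary b r a v < stationary b r a u"
proof -
  have "r / v < r / u"
    using assms by (intro divide_strict_left_mono) auto
  moreover have "(1 - r) / (1 - u) < (1 - r) / (1 - v)"
    using assms by (intro divide_strict_left_mono) auto
  moreover have "b * r * (u - a) \<le> b * r * (v - a)"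
    using assms by (intro mult_left_mono) auto
  ultimately show ?thesis
    unfolding stationary_def by linarith
qed

lemma stationary_ex1:
  assumes "0 < r" "r < 1" "0 \<le> b"
  shows "\<exists>!u. 0 < u \<and> u < 1 \<and> stationary b r a u = 0"
proof -
  \<comment> \<open>\<open>g\<close> is \<open>stationary\<close> multiplied by
    \<open>u * (1 - u)\<close>: a polynomial without poles at the endpoints, with
    \<open>g 0 = r > 0\<close> and \<open>g 1 = r - 1 < 0\<close>.\<close>
  define g where "g = (\<lambda>u. r - u - b * r * (u - a) * (u * (1 - u)))"
  have "\<exists>u\<ge>0. u \<le> 1 \<and> g u = 0"
    by (rule IVT2'[of g]) (use assms in \<open>auto simp: g_def intro!: continuous_intros\<close>)
  then obtain u where u: "0 \<le> u" "u \<le> 1" "g u = 0"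
    by blast
  have "u \<noteq> 0" "u \<noteq> 1"
    using u(3) assms by (auto simp: g_def)
  with u have u01: "0 < u" "u < 1"
    by auto
  have "stationary b r a u = g u / (u * (1 - u))"
    using u01 by (simp add: stationary_def g_def field_simps)
  with u(3) have "stationary b r a u = 0"
    by simp
  moreover have "v = u" if "0 < v" "v < 1" "stationary b r a v = 0" for v
    using stationary_strict_antimono[OF assms, of u v a] stationary_strict_antimono[OF assms, of v u a]
      that u01 \<open>stationary b r a u = 0\<close> by (cases u v rule: linorder_cases) auto
  ultimately show ?thesis
    using u01 by blast
qed

section \<open>Dependence of the root on its parameters\<close>

definition stationary_pt :: "real \<Rightarrow> real \<Rightarrow> real \<Rightarrow> real" where
  "stationary_pt b r a = (THE u. 0 < u \<and> u < 1 \<and> stationary b r a u = 0)"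

context
  fixes b r :: real
  assumes br: "0 < r" "r < 1" "0 \<le> b"
begin

lemma stationary_pt:
  "0 < stationary_pt b r a" "stationary_pt b r a < 1" "stationary b r a (stationary_pt b r a) = 0"
  using theI'[OF stationary_ex1[OF br, of a]] by (auto simp: stationary_pt_def)

text \<open>Strict monotonicity turns the comparison of the implicitly defined root with a threshold
  into the sign of an explicit expression. Continuity in \<open>a\<close> and measurability in
  \<open>r\<close> both come from this, without an implicit function theorem.\<close>

lemma stationary_pt_less_iff:
  assumes "0 < c" "c < 1"
  shows "stationary_pt b r a < c \<longleftrightarrow> stationary b r a c < 0"
    and "c < stationary_pt b r a \<longleftrightarrow> 0 < stationary b r a c"
  using stationary_strict_antimono[OF br, of "stationary_pt b r a" c a]
    stationary_strict_antimono[OF br, of c "stationary_pt b r a" a]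
    stationary_pt[of a] assms
  by (cases c "stationary_pt b r a" rule: linorder_cases; force)+

text \<open>At a fixed threshold \<open>c\<close> the stationarity expression is affine in
  \<open>a\<close>, so its strict sign at the limit persists eventually. Thresholds outside (0,1)
  are trivial because the root stays inside.\<close>

lemma tendsto_stationary_pt:
  assumes "(f \<longlongrightarrow> a) F"
  shows "((\<lambda>n. stationary_pt b r (f n)) \<longlongrightarrow> stationary_pt b r a) F"
proof (rule order_tendstoI)
  have lim: "((\<lambda>n. stationary b r (f n) c) \<longlongrightarrow> stationary b r a c) F" for c
    unfolding stationary_def by (intro tendsto_intros assms)
  fix c
  show "\<forall>\<^sub>F n in F. c < stationary_pt b r (f n)" if "c < stationary_pt b r a"
  proof (cases "0 < c")
    case True
    with that stationary_pt(2)[of a] have c: "0 < c" "c < 1"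
      by auto
    show ?thesis
      using order_tendstoD(1)[OF lim, of 0 c] that c by (simp add: stationary_pt_less_iff)
  qed (use stationary_pt(1) in \<open>auto intro!: always_eventually order.strict_trans1[of c 0]\<close>)
  show "\<forall>\<^sub>F n in F. stationary_pt b r (f n) < c" if "stationary_pt b r a < c"
  proof (cases "c < 1")
    case True
    with that stationary_pt(1)[of a] have c: "0 < c" "c < 1"
      by auto
    show ?thesis
      using order_tendstoD(2)[OF lim, of c 0] that c by (simp add: stationary_pt_less_iff)
  qed (use stationary_pt(2) in \<open>auto intro!: always_eventually order.strict_trans2[of _ 1 c]\<close>)
qed

text \<open>At a root, \<open>(r - u) / (u * (1 - u))\<close> equals \<open>b * r * (u - a)\<close>.
  The left side has the sign of \<open>r - u\<close>, the right side never has the sign opposite to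
  \<open>u - a\<close>, so u cannot lie strictly below both r and a, nor strictly above
  both.\<close>

lemma stationary_pt_bounds:
  "min r a \<le> stationary_pt b r a" "stationary_pt b r a \<le> max r a"
proof -
  define u where "u = stationary_pt b r a"
  have u: "0 < u" "u < 1" "stationary b r a u = 0"
    unfolding u_def by (rule stationary_pt)+
  have "r / u - (1 - r) / (1 - u) = (r - u) / (u * (1 - u))"
    using u by (simp add: field_simps)
  with u have eq: "(r - u) / (u * (1 - u)) = b * r * (u - a)"
    by (simp add: stationary_def)
  have "False" if "u < r" "u < a"
  proof -
    have "(r - u) / (u * (1 - u)) > 0"
      using that u by simp
    moreover have "b * r * (u - a) \<le> 0"
      using that br by (intro mult_nonneg_nonpos) auto
    ultimately show False
      using eq by simp
  qed
  moreover have "False" if "r < u" "a < u"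
  proof -
    have "(r - u) / (u * (1 - u)) < 0"
      using that u by (intro divide_neg_pos) auto
    moreover have "b * r * (u - a) \<ge> 0"
      using that br by auto
    ultimately show False
      using eq by simp
  qed
  ultimately show "min r a \<le> stationary_pt b r a" "stationary_pt b r a \<le> max r a"
    unfolding u_def[symmetric] min_le_iff_disj le_max_iff_disj by (meson not_less)+
qed

end

lemma measurable_stationary_pt:
  assumes b: "0 \<le> b"
    and r: "r \<in> borel_measurable M" "\<And>x. x \<in> space M \<Longrightarrow> 0 < r x \<and> r x < 1"
  shows "(\<lambda>x. stationary_pt b (r x) a) \<in> borel_measurable M"
proof (rule borel_measurableI_less)
  fix c :: real
  note [measurable] = r(1)
  consider "c \<le> 0" | "1 \<le> c" | "0 < c" "c < 1"
    by linarith
  then show "{x \<in> space M. stationary_pt b (r x) a < c} \<in> sets M"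
  proof cases
    case 1
    then have "\<not> stationary_pt b (r x) a < c" if "x \<in> space M" for x
      using stationary_pt(1)[of "r x" b a] r(2)[OF that] b by linarith
    then have "{x \<in> space M. stationary_pt b (r x) a < c} = {}"
      by blast
    then show ?thesis
      by (simp only: sets.empty_sets)
  next
    case 2
    then have "stationary_pt b (r x) a < c" if "x \<in> space M" for x
      using stationary_pt(2)[of "r x" b a] r(2)[OF that] b by linarith
    then have "{x \<in> space M. stationary_pt b (r x) a < c} = space M"
      by blast
    then show ?thesis
      by (simp only: sets.top)
  next
    case 3
    then have "{x \<in> space M. stationary_pt b (r x) a < c} = {x \<in> space M. stationary b (r x) a c < 0}"
      using stationary_pt_less_iff(1) r(2) b by auto
    also have "\<dots> \<in> sets M"
      unfolding stationary_def by measurable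
    finally show ?thesis .
  qed
qed

subsection \<open>Bounded discriminators\<close>

text \<open>Strict inequalities between essential bounds leave room for a real margin
  \<open>c\<close> beyond \<delta>. This form is the one used from here on, since an explicit margin
  yields bounds on logarithms and reciprocals.\<close>

lemma U_class_iff:
  assumes "0 \<le> \<delta>"
  shows "f \<in> U_class M \<delta> \<longleftrightarrow>
    f \<in> borel_measurable M \<and> (\<exists>c>\<delta>. AE x in M. c \<le> f x \<and> f x \<le> 1 - c)"
proof
  assume f: "f \<in> U_class M \<delta>"
  then have [measurable]: "f \<in> borel_measurable M"
    and lo: "ereal \<delta> < essinf M (\<lambda>x. ereal (f x))"
    and hi: "esssup M (\<lambda>x. ereal (f x)) < ereal (1 - \<delta>)"
    by (auto simp: U_class_def Linf_def)
  obtain c1 where c1: "ereal \<delta> < ereal c1" "ereal c1 < essinf M (\<lambda>x. ereal (f x))"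
    using ereal_dense2[OF lo] by blast
  obtain c2 where c2: "esssup M (\<lambda>x. ereal (f x)) < ereal c2" "ereal c2 < ereal (1 - \<delta>)"
    using ereal_dense2[OF hi] by blast
  have "AE x in M. - ereal (f x) \<le> - essinf M (\<lambda>x. ereal (f x))"
    using esssup_AE[of "\<lambda>x. - ereal (f x)" M] by (simp add: essinf_def)
  then have 1: "AE x in M. c1 \<le> f x"
    by eventually_elim (metis c1(2) ereal_less_eq(3) ereal_minus_le_minus less_imp_le order.trans)
  have 2: "AE x in M. f x \<le> c2"
    using esssup_AE[of "\<lambda>x. ereal (f x)" M]
    by eventually_elim (metis c2(1) ereal_less_eq(3) less_imp_le order.trans)
  have "AE x in M. min c1 (1 - c2) \<le> f x \<and> f x \<le> 1 - min c1 (1 - c2)"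
    using 1 2 by eventually_elim auto
  moreover have "min c1 (1 - c2) > \<delta>"
    using c1 c2 by auto
  ultimately show "f \<in> borel_measurable M \<and> (\<exists>c>\<delta>. AE x in M. c \<le> f x \<and> f x \<le> 1 - c)"
    using \<open>f \<in> borel_measurable M\<close> by blast
next
  assume "f \<in> borel_measurable M \<and> (\<exists>c>\<delta>. AE x in M. c \<le> f x \<and> f x \<le> 1 - c)"
  then obtain c where [measurable]: "f \<in> borel_measurable M" and c: "c > \<delta>"
    and AE: "AE x in M. c \<le> f x \<and> f x \<le> 1 - c"
    by blast
  have "AE x in M. ereal \<bar>f x\<bar> \<le> ereal 1"
    using AE by eventually_elim (use c assms in auto)
  then have "esssup M (\<lambda>x. ereal \<bar>f x\<bar>) \<le> ereal 1"
    by (intro esssup_I) auto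
  then have "f \<in> Linf M"
    by (auto simp: Linf_def)
  have "esssup M (\<lambda>x. - ereal (f x)) \<le> ereal (- c)"
    by (rule esssup_I) (use AE in \<open>auto elim!: eventually_mono\<close>)
  then have "ereal c \<le> essinf M (\<lambda>x. ereal (f x))"
    unfolding essinf_def by (metis ereal_minus_le_minus uminus_ereal.simps(1) ereal_uminus_uminus)
  then have 1: "ereal \<delta> < essinf M (\<lambda>x. ereal (f x))"
    using c by (meson ereal_less(1) less_ereal.simps(1) order.strict_trans2)
  have "esssup M (\<lambda>x. ereal (f x)) \<le> ereal (1 - c)"
    by (rule esssup_I) (use AE in \<open>auto elim!: eventually_mono\<close>)
  then have 2: "esssup M (\<lambda>x. ereal (f x)) < ereal (1 - \<delta>)"
    using c by (meson diff_strict_left_mono less_ereal.simps(1) order.strict_trans1)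
  from 1 2 \<open>f \<in> Linf M\<close> show "f \<in> U_class M \<delta>"
    by (simp add: U_class_def)
qed

subsection \<open>Expectations of nonpositive functions\<close>

lemma (in prob_space) ext_expectation_const:
  assumes "\<And>x. x \<in> space M \<Longrightarrow> f x = c" and "c \<le> 0"
  shows "ext_expectation M f = ereal c"
proof -
  have "(\<integral>\<^sup>+ x. ennreal (f x) \<partial>M) = (\<integral>\<^sup>+ x. ennreal c \<partial>M)"
    "(\<integral>\<^sup>+ x. ennreal (- f x) \<partial>M) = (\<integral>\<^sup>+ x. ennreal (- c) \<partial>M)"
    using assms(1) by (auto intro!: nn_integral_cong simp del: nn_integral_const)
  then show ?thesis
    using assms(2)
    by (simp add: ext_expectation_def emeasure_space_1 ennreal_neg enn2ereal_ennreal zero_ennreal.rep_eq)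
qed

text \<open>The positive part of f vanishes, so the expectation is minus a nonnegative integral and
  may be \<open>-\<infinity>\<close>. If it equals the finite number c, then f is integrable, and
  \<open>c - f\<close> is a nonnegative function with integral 0. Applied to the expectation over t,
  the second claim gives uniqueness for almost every t.\<close>

lemma (in prob_space) ext_expectation_le:
  assumes [measurable]: "f \<in> borel_measurable M"
    and le: "\<And>x. x \<in> space M \<Longrightarrow> f x \<le> c" and "c \<le> 0"
  shows "ext_expectation M f \<le> ereal c"
    and "ext_expectation M f = ereal c \<Longrightarrow> AE x in M. f x = c"
proof -
  have "(\<integral>\<^sup>+ x. ennreal (f x) \<partial>M) = (\<integral>\<^sup>+ x. 0 \<partial>M)"
    using le \<open>c \<le> 0\<close> by (intro nn_integral_cong) (auto intro!: ennreal_neg intro: order.trans)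
  then have ext: "ext_expectation M f = - enn2ereal (\<integral>\<^sup>+ x. ennreal (- f x) \<partial>M)"
    by (simp add: ext_expectation_def zero_ennreal.rep_eq)
  have "(\<integral>\<^sup>+ x. ennreal (- c) \<partial>M) \<le> (\<integral>\<^sup>+ x. ennreal (- f x) \<partial>M)"
    using le by (intro nn_integral_mono) (auto intro!: ennreal_leI)
  then have "ennreal (- c) \<le> (\<integral>\<^sup>+ x. ennreal (- f x) \<partial>M)"
    by (simp add: emeasure_space_1)
  then have "ereal (- c) \<le> enn2ereal (\<integral>\<^sup>+ x. ennreal (- f x) \<partial>M)"
    using \<open>c \<le> 0\<close> by (simp add: less_eq_ennreal.rep_eq enn2ereal_ennreal)
  then show "ext_expectation M f \<le> ereal c"
    unfolding ext by (metis ereal_minus_le_minus uminus_ereal.simps(1) ereal_uminus_uminus)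
  assume "ext_expectation M f = ereal c"
  then have "enn2ereal (\<integral>\<^sup>+ x. ennreal (- f x) \<partial>M) = ereal (- c)"
    unfolding ext by (metis ereal_uminus_uminus uminus_ereal.simps(1))
  then have nn: "(\<integral>\<^sup>+ x. ennreal (- f x) \<partial>M) = ennreal (- c)"
    using \<open>c \<le> 0\<close> by (metis e2ennreal_enn2ereal e2ennreal_ereal)
  have nonneg: "AE x in M. 0 \<le> - f x"
    using le \<open>c \<le> 0\<close> by (intro AE_I2) force
  have int: "integrable M (\<lambda>x. - f x)"
    by (rule integrableI_nn_integral_finite[OF _ nonneg nn]) simp
  have "(\<integral>x. - f x \<partial>M) = - c"
    using nn nonneg \<open>c \<le> 0\<close> by (subst integral_eq_nn_integral) auto
  then have "(\<integral>x. c - f x \<partial>M) = 0"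
    using int by (simp add: prob_space)
  then have "AE x in M. c - f x = 0"
    using int le by (subst (asm) integral_nonneg_eq_0_iff_AE) auto
  then show "AE x in M. f x = c"
    by eventually_elim simp
qed

section \<open>Closure properties of essentially bounded functions\<close>

lemma Linf_iff:
  "f \<in> Linf M \<longleftrightarrow> f \<in> borel_measurable M \<and> (\<exists>B. AE x in M. \<bar>f x\<bar> \<le> B)"
proof
  assume f: "f \<in> Linf M"
  then have "esssup M (\<lambda>x. ereal \<bar>f x\<bar>) < \<infinity>"
    by (simp add: Linf_def)
  then obtain B where B: "esssup M (\<lambda>x. ereal \<bar>f x\<bar>) < ereal B"
    using ereal_dense2 by blast
  have "AE x in M. \<bar>f x\<bar> \<le> B"
    using esssup_AE[of "\<lambda>x. ereal \<bar>f x\<bar>" M]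
    by eventually_elim (metis B ereal_less_eq(3) less_imp_le order.trans)
  then show "f \<in> borel_measurable M \<and> (\<exists>B. AE x in M. \<bar>f x\<bar> \<le> B)"
    using f by (auto simp: Linf_def)
next
  assume "f \<in> borel_measurable M \<and> (\<exists>B. AE x in M. \<bar>f x\<bar> \<le> B)"
  then obtain B where [measurable]: "f \<in> borel_measurable M" and "AE x in M. \<bar>f x\<bar> \<le> B"
    by blast
  then have "esssup M (\<lambda>x. ereal \<bar>f x\<bar>) \<le> ereal B"
    by (intro esssup_I) auto
  then show "f \<in> Linf M"
    by (auto simp: Linf_def)
qed

lemma Linf_measurable: "f \<in> Linf M \<Longrightarrow> f \<in> borel_measurable M"
  by (simp add: Linf_def)

lemma Linf_const [intro]: "(\<lambda>_. c) \<in> Linf M"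
  by (auto simp: Linf_iff)

lemma Linf_add [intro]: "(\<lambda>x. f x + g x) \<in> Linf M" if fg: "f \<in> Linf M" "g \<in> Linf M"
proof -
  obtain A B where "AE x in M. \<bar>f x\<bar> \<le> A" "AE x in M. \<bar>g x\<bar> \<le> B"
    using fg by (auto simp: Linf_iff)
  then have "AE x in M. \<bar>f x + g x\<bar> \<le> A + B"
    by eventually_elim simp
  then show ?thesis
    using fg by (auto simp: Linf_iff)
qed

lemma Linf_mult [intro]: "(\<lambda>x. f x * g x) \<in> Linf M" if fg: "f \<in> Linf M" "g \<in> Linf M"
proof -
  obtain A B where "AE x in M. \<bar>f x\<bar> \<le> A" "AE x in M. \<bar>g x\<bar> \<le> B"
    using fg by (auto simp: Linf_iff)
  then have "AE x in M. \<bar>f x * g x\<bar> \<le> A * B"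
    by eventually_elim (auto simp: abs_mult intro!: mult_mono)
  then show ?thesis
    using fg by (auto simp: Linf_iff)
qed

lemma Linf_diff [intro]: "(\<lambda>x. f x - g x) \<in> Linf M" if "f \<in> Linf M" "g \<in> Linf M"
  using Linf_add[OF that(1) Linf_mult[OF Linf_const[of "-1"] that(2)]] by simp

lemma Linf_power2 [intro]: "(\<lambda>x. (f x)\<^sup>2) \<in> Linf M" if "f \<in> Linf M"
  using Linf_mult[OF that that] by (simp add: power2_eq_square)

lemma U_class_AE: "AE x in M. 0 < f x \<and> f x < 1" if f: "f \<in> U_class M 0"
proof -
  obtain c where "c > 0" "AE x in M. c \<le> f x \<and> f x \<le> 1 - c"
    using f by (auto simp: U_class_iff)
  from this(2) show ?thesis
    by eventually_elim (use \<open>c > 0\<close> in auto)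
qed

lemma U_class_compl: "(\<lambda>x. 1 - f x) \<in> U_class M 0" if f: "f \<in> U_class M 0"
proof -
  obtain c where "f \<in> borel_measurable M" "c > 0" "AE x in M. c \<le> f x \<and> f x \<le> 1 - c"
    using f by (auto simp: U_class_iff)
  then show ?thesis
    by (auto simp: U_class_iff intro!: exI[of _ c])
qed

text \<open>The margin keeps f away from the singularity of \<open>ln\<close> and of the reciprocal
  at 0. Together with \<open>U_class_compl\<close> this also covers \<open>1 - f\<close>, so that
  all terms of the payoff are bounded and split freely under the integral.\<close>

lemma U_class_Linf:
  assumes f: "f \<in> U_class M 0"
  shows "f \<in> Linf M" "(\<lambda>x. ln (f x)) \<in> Linf M" "(\<lambda>x. 1 / f x) \<in> Linf M"
proof -
  obtain c where [measurable]: "f \<in> borel_measurable M" and c: "c > 0"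
    and AE: "AE x in M. c \<le> f x \<and> f x \<le> 1 - c"
    using f by (auto simp: U_class_iff)
  show "f \<in> Linf M"
    using f by (simp add: U_class_def)
  have "AE x in M. \<bar>ln (f x)\<bar> \<le> - ln c"
    using AE
  proof eventually_elim
    case (elim x)
    then have "ln c \<le> ln (f x)" "ln (f x) \<le> 0"
      using c by auto
    then show ?case
      by auto
  qed
  then show "(\<lambda>x. ln (f x)) \<in> Linf M"
    by (auto simp: Linf_iff)
  have "AE x in M. \<bar>1 / f x\<bar> \<le> 1 / c"
    using AE by eventually_elim (use c in \<open>auto simp: frac_le\<close>)
  then show "(\<lambda>x. 1 / f x) \<in> Linf M"
    by (auto simp: Linf_iff)
qed

lemma U_class_mono: "U_class M \<delta> \<subseteq> U_class M \<epsilon>" if "0 \<le> \<epsilon>" "\<epsilon> \<le> \<delta>"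
proof
  fix f assume "f \<in> U_class M \<delta>"
  moreover have "0 \<le> \<delta>"
    using that by simp
  ultimately show "f \<in> U_class M \<epsilon>"
    using that by (meson U_class_iff order.strict_trans1)
qed

subsection \<open>The objective at a fixed time\<close>

definition payoff :: "'a measure \<Rightarrow> 'a measure \<Rightarrow> real \<Rightarrow> ('a \<Rightarrow> real) \<Rightarrow> real" where
  "payoff P Q lam v =
     (\<integral>x. ln (v x) \<partial>P) + (\<integral>x. ln (1 - v x) \<partial>Q) - lam * prob_space.variance P v"

text \<open>The deficit in the tangent inequality \<open>ln y \<le> y - 1\<close>, which is the
  integrand of the Itakura-Saito divergence.\<close>

definition log_gap :: "real \<Rightarrow> real" where
  "log_gap y = y - 1 - ln y"

lemma log_gap_nonneg: "0 < y \<Longrightarrow> 0 \<le> log_gap y"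
  using ln_le_minus_one[of y] by (simp add: log_gap_def)

lemma log_gap_eq_0: "0 < y \<Longrightarrow> log_gap y = 0 \<Longrightarrow> y = 1"
  using ln_eq_minus_one[of y] by (simp add: log_gap_def)

text \<open>A strictly positive density leaves the null sets unchanged. Hence statements holding
  almost everywhere under P, Q or the base measure are interchangeable.\<close>

lemma AE_prob_with:
  assumes "pos_prob_density M p"
  shows "(AE x in prob_with M p. A x) \<longleftrightarrow> (AE x in M. A x)"
proof -
  have "(AE x in prob_with M p. A x) \<longleftrightarrow> (AE x in M. 0 < ennreal (p x) \<longrightarrow> A x)"
    using assms by (intro AE_density) (auto simp: pos_prob_density_def)
  also have "\<dots> \<longleftrightarrow> (AE x in M. A x)"
    using assms by (intro AE_cong) (auto simp: pos_prob_density_def)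
  finally show ?thesis .
qed

lemma integral_prob_with:
  assumes p: "pos_prob_density M p" and f: "f \<in> Linf M"
  shows "integrable (prob_with M p) f"
    and "integrable M (\<lambda>x. p x * f x)"
    and "(\<integral>x. f x \<partial>prob_with M p) = (\<integral>x. p x * f x \<partial>M)"
proof -
  interpret prob_space "prob_with M p"
    using p by (simp add: pos_prob_density_def)
  have pm: "p \<in> borel_measurable M" "AE x in M. 0 \<le> p x"
    using p by (auto simp: pos_prob_density_def intro!: AE_I2 less_imp_le)
  have fm: "f \<in> borel_measurable M"
    using f by (rule Linf_measurable)
  obtain B where "AE x in M. \<bar>f x\<bar> \<le> B"
    using f by (auto simp: Linf_iff)
  then show int: "integrable (prob_with M p) f"
    using fm by (intro integrable_const_bound[of _ B]) (auto simp: AE_prob_with[OF p])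
  show "integrable M (\<lambda>x. p x * f x)"
    using int by (subst (asm) integrable_density) (use fm pm in auto)
  show "(\<integral>x. f x \<partial>prob_with M p) = (\<integral>x. p x * f x \<partial>M)"
    by (subst integral_density) (use fm pm in auto)
qed

text \<open>Both logarithms are taken of numbers in (0,1) and the variance is subtracted. The sign
  supplies the hypothesis \<open>c \<le> 0\<close> of the lemmas on
  \<open>ext_expectation\<close>.\<close>

lemma payoff_nonpos:
  assumes p: "pos_prob_density M p" and q: "pos_prob_density M q" and "0 \<le> lam"
    and v: "v \<in> U_class M 0"
  shows "payoff (prob_with M p) (prob_with M q) lam v \<le> 0"
proof -
  interpret P: prob_space "prob_with M p"
    using p by (simp add: pos_prob_density_def)
  have ln_le: "(\<integral>x. ln (w x) \<partial>prob_with M g) \<le> 0"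
    if w: "w \<in> U_class M 0" and g: "pos_prob_density M g" for w g
  proof -
    have "AE x in M. 0 \<le> - ln (w x)"
      using U_class_AE[OF w] by eventually_elim simp
    then have "0 \<le> (\<integral>x. - ln (w x) \<partial>prob_with M g)"
      by (intro integral_nonneg_AE) (simp add: AE_prob_with[OF g])
    then show ?thesis
      by simp
  qed
  have "0 \<le> lam * P.variance v"
    using \<open>0 \<le> lam\<close> P.variance_positive[of v] by (rule mult_nonneg_nonneg)
  then show ?thesis
    using ln_le[OF v p] ln_le[OF U_class_compl[OF v] q] by (simp add: payoff_def)
qed

lemma variance_expansion:
  fixes u v :: "'a \<Rightarrow> real"
  assumes "prob_space P" and int: "\<And>f. f \<in> Linf P \<Longrightarrow> integrable P f"
    and u: "u \<in> Linf P" and v: "v \<in> Linf P"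
  shows "prob_space.variance P v = prob_space.variance P u
    + 2 * (\<integral>x. (u x - (\<integral>x. u x \<partial>P)) * (v x - u x) \<partial>P)
    + prob_space.variance P (\<lambda>x. v x - u x)"
proof -
  interpret prob_space P by fact
  define m k where "m = (\<integral>x. u x \<partial>P)" and "k = (\<integral>x. v x \<partial>P)"
  have [simp]: "integrable P u" "integrable P v"
    using u v by (auto intro: int)
  have w: "(\<integral>x. v x - u x \<partial>P) = k - m"
    by (simp add: m_def k_def)
  have i1: "integrable P (\<lambda>x. (u x - m)\<^sup>2)" and i2: "integrable P (\<lambda>x. (u x - m) * (v x - u x))"
    and i3: "integrable P (\<lambda>x. (v x - u x - (k - m))\<^sup>2)"
    by (intro int Linf_power2 Linf_diff Linf_mult Linf_const u v)+
  have i4: "integrable P (\<lambda>x. 2 * (k - m) * (u x - m))"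
    by simp
  have i4': "(\<integral>x. 2 * (k - m) * (u x - m) \<partial>P) = 0"
    by (simp add: m_def prob_space)
  \<comment> \<open>Square of \<open>v - k = (u - m) + (v - u - (k - m))\<close>. In the cross term
    the constant \<open>k - m\<close> contributes nothing, because \<open>u - m\<close> has mean 0;
    this is why \<open>v - u\<close> appears uncentered in the covariance.\<close>
  have "(\<integral>x. (v x - k)\<^sup>2 \<partial>P) = (\<integral>x. (u x - m)\<^sup>2 + 2 * ((u x - m) * (v x - u x))
      - 2 * (k - m) * (u x - m) + (v x - u x - (k - m))\<^sup>2 \<partial>P)"
    by (intro Bochner_Integration.integral_cong) (auto simp: power2_eq_square algebra_simps)
  also have "\<dots> = (\<integral>x. (u x - m)\<^sup>2 \<partial>P) + 2 * (\<integral>x. (u x - m) * (v x - u x) \<partial>P)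
      + (\<integral>x. (v x - u x - (k - m))\<^sup>2 \<partial>P)"
    using i1 i2 i3 i4 i4' by (simp del: integral_mult_right_zero)
  finally show ?thesis
    unfolding w m_def[symmetric] k_def[symmetric] .
qed

section \<open>A stationary discriminator maximizes the slice objective\<close>

context
  fixes M :: "'a measure" and p q :: "'a \<Rightarrow> real" and lam :: real
  assumes p: "pos_prob_density M p" and q: "pos_prob_density M q" and lam: "0 \<le> lam"
begin

text \<open>Each \<open>log_gap\<close> is a first-order term minus a difference of logarithms. By
  stationarity the first-order terms under P and Q add up to \<open>2 * lam\<close> times the
  covariance of u and \<open>v - u\<close>, which is exactly the cross term, weighted by
  \<open>lam\<close>, in \<open>variance_expansion\<close>. What remains is an identity, not merely
  an inequality.\<close>

lemma payoff_gap:
  assumes u: "u \<in> U_class M 0" and u01: "\<And>x. x \<in> space M \<Longrightarrow> 0 < u x \<and> u x < 1"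
    and st: "\<And>x. x \<in> space M \<Longrightarrow>
      stationary (2 * lam) (p x / (p x + q x)) (\<integral>x. u x \<partial>prob_with M p) (u x) = 0"
    and v: "v \<in> U_class M 0"
  shows "payoff (prob_with M p) (prob_with M q) lam u - payoff (prob_with M p) (prob_with M q) lam v
    = (\<integral>x. log_gap (v x / u x) \<partial>prob_with M p)
      + (\<integral>x. log_gap ((1 - v x) / (1 - u x)) \<partial>prob_with M q)
      + lam * prob_space.variance (prob_with M p) (\<lambda>x. v x - u x)"
proof -
  let ?P = "prob_with M p" and ?Q = "prob_with M q"
  interpret P: prob_space ?P
    using p by (simp add: pos_prob_density_def)
  interpret Q: prob_space ?Q
    using q by (simp add: pos_prob_density_def)
  note intP = integral_prob_with(1)[OF p] and intQ = integral_prob_with(1)[OF q]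
  define m where "m = (\<integral>x. u x \<partial>?P)"
  note u' = U_class_compl[OF u] and v' = U_class_compl[OF v]
  note Linf = U_class_Linf[OF u] U_class_Linf[OF v] U_class_Linf[OF u'] U_class_Linf[OF v']
  have slopeP: "(\<lambda>x. (v x - u x) / u x) \<in> Linf M"
    using Linf_mult[OF Linf_diff[OF Linf(4,1)] Linf(3)] by simp
  have slopeQ: "(\<lambda>x. (v x - u x) / (1 - u x)) \<in> Linf M"
    using Linf_mult[OF Linf_diff[OF Linf(4,1)] Linf(9)] by simp
  have cov: "(\<lambda>x. (u x - m) * (v x - u x)) \<in> Linf M"
    by (intro Linf_mult Linf_diff Linf_const Linf)
  have v01: "AE x in M. 0 < v x \<and> v x < 1"
    using v by (rule U_class_AE)
  have lg: "(\<integral>x. log_gap (v x / u x) \<partial>?P)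
      = (\<integral>x. (v x - u x) / u x - (ln (v x) - ln (u x)) \<partial>?P)"
  proof (rule integral_cong_AE)
    have [measurable]: "u \<in> borel_measurable M" "v \<in> borel_measurable M"
      using Linf by (auto simp: Linf_def)
    show "(\<lambda>x. log_gap (v x / u x)) \<in> borel_measurable ?P"
      "(\<lambda>x. (v x - u x) / u x - (ln (v x) - ln (u x))) \<in> borel_measurable ?P"
      unfolding log_gap_def by measurable
    show "AE x in ?P. log_gap (v x / u x) = (v x - u x) / u x - (ln (v x) - ln (u x))"
      unfolding AE_prob_with[OF p] using v01 AE_space
      by eventually_elim (use u01 in \<open>auto simp: log_gap_def ln_div diff_divide_distrib dest!: u01\<close>)
  qed
  have lgQ: "(\<integral>x. log_gap ((1 - v x) / (1 - u x)) \<partial>?Q)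
      = (\<integral>x. - ((v x - u x) / (1 - u x)) - (ln (1 - v x) - ln (1 - u x)) \<partial>?Q)"
  proof (rule integral_cong_AE)
    have [measurable]: "u \<in> borel_measurable M" "v \<in> borel_measurable M"
      using Linf by (auto simp: Linf_def)
    show "(\<lambda>x. log_gap ((1 - v x) / (1 - u x))) \<in> borel_measurable ?Q"
      "(\<lambda>x. - ((v x - u x) / (1 - u x)) - (ln (1 - v x) - ln (1 - u x))) \<in> borel_measurable ?Q"
      unfolding log_gap_def by measurable
    show "AE x in ?Q. log_gap ((1 - v x) / (1 - u x))
        = - ((v x - u x) / (1 - u x)) - (ln (1 - v x) - ln (1 - u x))"
      unfolding AE_prob_with[OF q] using v01 AE_space
    proof eventually_elim
      case (elim x)
      with u01[of x] show ?case
        by (simp add: log_gap_def ln_div divide_simps)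
    qed
  qed
  have first_order: "(\<integral>x. (v x - u x) / u x \<partial>?P) - (\<integral>x. (v x - u x) / (1 - u x) \<partial>?Q)
      = 2 * lam * (\<integral>x. (u x - m) * (v x - u x) \<partial>?P)"
  proof -
    have "(\<integral>x. (v x - u x) / u x \<partial>?P) - (\<integral>x. (v x - u x) / (1 - u x) \<partial>?Q)
        = (\<integral>x. p x * ((v x - u x) / u x) - q x * ((v x - u x) / (1 - u x)) \<partial>M)"
      unfolding integral_prob_with(3)[OF p slopeP] integral_prob_with(3)[OF q slopeQ]
      by (rule Bochner_Integration.integral_diff[symmetric]
          integral_prob_with(2)[OF p slopeP] integral_prob_with(2)[OF q slopeQ])+
    also have "\<dots> = (\<integral>x. 2 * lam * (p x * ((u x - m) * (v x - u x))) \<partial>M)"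
    proof (rule Bochner_Integration.integral_cong[OF refl])
      fix x assume x: "x \<in> space M"
      then have pq: "0 < p x" "0 < q x"
        using p q by (auto simp: pos_prob_density_def)
      define r where "r = p x / (p x + q x)"
      have r: "r * (p x + q x) = p x" "(1 - r) * (p x + q x) = q x"
        using pq by (auto simp: r_def field_simps)
      \<comment> \<open>Multiplying by \<open>p + q\<close> turns the weights r and 1 - r back into
        the densities p and q.\<close>
      have "0 = (p x + q x) * (r / u x - (1 - r) / (1 - u x) - 2 * lam * r * (u x - m))"
        using st[OF x] by (simp add: stationary_def r_def m_def)
      also have "\<dots> = r * (p x + q x) / u x - (1 - r) * (p x + q x) / (1 - u x)
          - 2 * lam * (r * (p x + q x)) * (u x - m)"
        by (simp add: algebra_simps add_divide_distrib diff_divide_distrib)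
      finally have "p x / u x - q x / (1 - u x) = 2 * lam * p x * (u x - m)"
        unfolding r by simp
      then have "(p x / u x - q x / (1 - u x)) * (v x - u x)
          = 2 * lam * p x * (u x - m) * (v x - u x)"
        by simp
      then show "p x * ((v x - u x) / u x) - q x * ((v x - u x) / (1 - u x))
          = 2 * lam * (p x * ((u x - m) * (v x - u x)))"
        by (simp add: algebra_simps diff_divide_distrib)
    qed
    also have "\<dots> = 2 * lam * (\<integral>x. (u x - m) * (v x - u x) \<partial>?P)"
      unfolding integral_prob_with(3)[OF p cov] by simp
    finally show ?thesis .
  qed
  have LinfP: "f \<in> Linf ?P \<longleftrightarrow> f \<in> Linf M" for f
    by (simp add: Linf_iff AE_prob_with[OF p])
  have var: "P.variance v = P.variance u + 2 * (\<integral>x. (u x - m) * (v x - u x) \<partial>?P)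
      + P.variance (\<lambda>x. v x - u x)"
    unfolding m_def
    by (rule variance_expansion[OF P.prob_space_axioms]) (use intP Linf LinfP in auto)
  have 1: "(\<integral>x. log_gap (v x / u x) \<partial>?P)
      = (\<integral>x. (v x - u x) / u x \<partial>?P) - ((\<integral>x. ln (v x) \<partial>?P) - (\<integral>x. ln (u x) \<partial>?P))"
    unfolding lg using intP[OF slopeP] intP[OF Linf(2)] intP[OF Linf(5)] by simp
  have 2: "(\<integral>x. log_gap ((1 - v x) / (1 - u x)) \<partial>?Q)
      = - (\<integral>x. (v x - u x) / (1 - u x) \<partial>?Q)
        - ((\<integral>x. ln (1 - v x) \<partial>?Q) - (\<integral>x. ln (1 - u x) \<partial>?Q))"
    unfolding lgQ using intQ[OF slopeQ] intQ[OF Linf(8)] intQ[OF Linf(11)] by simp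
  have "lam * P.variance v = lam * P.variance u + 2 * lam * (\<integral>x. (u x - m) * (v x - u x) \<partial>?P)
      + lam * P.variance (\<lambda>x. v x - u x)"
    unfolding var by (simp add: algebra_simps)
  then show ?thesis
    unfolding payoff_def using first_order 1 2 by linarith
qed

text \<open>The three terms of the gap are nonnegative. If the gap is 0, the P-integral of
  \<open>log_gap (v / u)\<close> vanishes, and \<open>log_gap\<close> is 0 only at 1.\<close>

lemma payoff_stationary_max:
  assumes u: "u \<in> U_class M 0" and u01: "\<And>x. x \<in> space M \<Longrightarrow> 0 < u x \<and> u x < 1"
    and st: "\<And>x. x \<in> space M \<Longrightarrow>
      stationary (2 * lam) (p x / (p x + q x)) (\<integral>x. u x \<partial>prob_with M p) (u x) = 0"
    and v: "v \<in> U_class M 0"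
  shows "payoff (prob_with M p) (prob_with M q) lam v \<le> payoff (prob_with M p) (prob_with M q) lam u"
    and "payoff (prob_with M p) (prob_with M q) lam v = payoff (prob_with M p) (prob_with M q) lam u
      \<Longrightarrow> AE x in M. v x = u x"
proof -
  let ?P = "prob_with M p" and ?Q = "prob_with M q"
  interpret P: prob_space ?P
    using p by (simp add: pos_prob_density_def)
  have v01: "AE x in M. 0 < v x \<and> v x < 1"
    using v by (rule U_class_AE)
  have ratio_pos: "AE x in M. 0 < v x / u x \<and> 0 < (1 - v x) / (1 - u x)"
    using v01 AE_space by eventually_elim (use u01 in auto)
  then have gap1: "AE x in ?P. 0 \<le> log_gap (v x / u x)"
    unfolding AE_prob_with[OF p] by eventually_elim (simp add: log_gap_nonneg)
  have gap2: "AE x in ?Q. 0 \<le> log_gap ((1 - v x) / (1 - u x))"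
    using ratio_pos unfolding AE_prob_with[OF q] by eventually_elim (simp add: log_gap_nonneg)
  note nn = integral_nonneg_AE[OF gap1] integral_nonneg_AE[OF gap2]
    mult_nonneg_nonneg[OF lam P.variance_positive[of "\<lambda>x. v x - u x"]]
  note gap = payoff_gap[OF u u01 st v]
  show "payoff ?P ?Q lam v \<le> payoff ?P ?Q lam u"
    using nn gap by linarith
  assume "payoff ?P ?Q lam v = payoff ?P ?Q lam u"
  then have zero: "(\<integral>x. log_gap (v x / u x) \<partial>?P) = 0"
    using nn gap by linarith
  have [measurable]: "u \<in> borel_measurable M" "v \<in> borel_measurable M"
    using u v by (auto simp: U_class_iff)
  have ratio_Linf: "(\<lambda>x. v x / u x) \<in> Linf M"
    using Linf_mult[OF U_class_Linf(1)[OF v] U_class_Linf(3)[OF u]] by simp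
  \<comment> \<open>The Bochner integral of a non-integrable function is 0 by default, so
    integrability has to be secured before a vanishing integral says anything about the
    integrand.\<close>
  have "integrable ?P (\<lambda>x. v x / u x - 1 - (ln (v x) - ln (u x)))"
    by (intro integral_prob_with(1)[OF p] Linf_diff Linf_const ratio_Linf U_class_Linf(2) u v)
  moreover have "AE x in ?P. log_gap (v x / u x) = v x / u x - 1 - (ln (v x) - ln (u x))"
    unfolding AE_prob_with[OF p] using v01 AE_space
    by eventually_elim (auto simp: log_gap_def ln_div dest!: u01)
  moreover have "(\<lambda>x. log_gap (v x / u x)) \<in> borel_measurable ?P"
    unfolding log_gap_def by measurable
  ultimately have "integrable ?P (\<lambda>x. log_gap (v x / u x))"
    by (subst integrable_cong_AE) auto
  then have "AE x in M. log_gap (v x / u x) = 0"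
    using integral_nonneg_eq_0_iff_AE[OF _ gap1] zero by (simp add: AE_prob_with[OF p])
  then show "AE x in M. v x = u x"
    using ratio_pos AE_space
  proof eventually_elim
    case (elim x)
    then have "v x / u x = 1"
      by (intro log_gap_eq_0) auto
    then show ?case
      by (simp add: divide_eq_1_iff)
  qed
qed

text \<open>The mean in the stationarity condition is that of the unknown itself. Solving first for
  a prescribed mean \<open>a\<close> reduces this self-consistency to a fixed point of the scalar
  function \<open>f\<close>, which maps \<open>a\<close> to the mean of the solution.\<close>

lemma ex_payoff_stationary:
  assumes ratio: "(\<lambda>x. p x / (p x + q x)) \<in> U_class M 0"
  obtains u where "u \<in> U_class M 0" "\<And>x. x \<in> space M \<Longrightarrow> 0 < u x \<and> u x < 1"
    "\<And>x. x \<in> space M \<Longrightarrow>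
      stationary (2 * lam) (p x / (p x + q x)) (\<integral>x. u x \<partial>prob_with M p) (u x) = 0"
proof -
  let ?P = "prob_with M p"
  interpret P: prob_space ?P
    using p by (simp add: pos_prob_density_def)
  define r where "r = (\<lambda>x. p x / (p x + q x))"
  have r01: "0 < r x" "r x < 1" if "x \<in> space M" for x
  proof -
    have "0 < p x" "0 < q x"
      using that p q by (auto simp: pos_prob_density_def)
    then show "0 < r x" "r x < 1"
      by (auto simp: r_def)
  qed
  have b: "0 \<le> 2 * lam"
    using lam by simp
  have r_meas: "r \<in> borel_measurable M"
    using ratio by (simp add: U_class_iff r_def)
  define U where "U = (\<lambda>a x. stationary_pt (2 * lam) (r x) a)"
  have U: "0 < U a x" "U a x < 1" "stationary (2 * lam) (r x) a (U a x) = 0"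
    "min (r x) a \<le> U a x" "U a x \<le> max (r x) a" if "x \<in> space M" for a x
    unfolding U_def using stationary_pt[OF r01[OF that] b] stationary_pt_bounds[OF r01[OF that] b]
    by auto
  have U_meas: "U a \<in> borel_measurable M" for a
    unfolding U_def using r01 by (intro measurable_stationary_pt b r_meas) auto
  have U_int: "integrable ?P (U a)" for a
    using U_meas[of a] U(1,2)[of _ a]
    by (intro P.integrable_const_bound[of _ 1]) (auto intro!: AE_I2 simp: abs_le_iff less_imp_le intro: order.trans[of _ 0])
  define f where "f = (\<lambda>a. \<integral>x. U a x \<partial>?P)"
  \<comment> \<open>Strictness matters: it places the fixed point \<open>m\<close> strictly inside
    (0,1), which the margin \<open>c'\<close> below relies on.\<close>
  have f01: "0 < f a" "f a < 1" for a
    unfolding f_def using U(1,2)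
    by (auto intro!: P.expectation_greater P.expectation_less U_int AE_I2)
  have "continuous_on {0..1} f"
    unfolding continuous_on_sequentially
  proof (intro allI ballI impI, elim conjE)
    fix X and a :: real
    assume "X \<longlonglongrightarrow> a"
    then have lim: "(\<lambda>n. U (X n) x) \<longlonglongrightarrow> U a x" if "x \<in> space M" for x
      unfolding U_def using r01[OF that] b by (intro tendsto_stationary_pt) auto
    show "(f \<circ> X) \<longlonglongrightarrow> f a"
      unfolding f_def comp_def
    proof (rule integral_dominated_convergence[where w = "\<lambda>_. 1"])
      show "AE x in ?P. (\<lambda>i. U (X i) x) \<longlonglongrightarrow> U a x"
        using lim by (auto intro!: AE_I2)
      show "AE x in ?P. norm (U (X i) x) \<le> 1" for i
        using U(1,2)[of _ "X i"] by (auto intro!: AE_I2 simp: abs_le_iff less_imp_le intro: order.trans[of _ 0])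
    qed (use U_meas in auto)
  qed
  \<comment> \<open>The function \<open>f a - a\<close> is positive at 0 and negative at 1.\<close>
  then have "\<exists>m\<ge>0. m \<le> 1 \<and> f m - m = 0"
    using f01 by (intro IVT2') (auto intro!: continuous_intros simp: less_imp_le)
  then obtain m where "f m = m"
    by auto
  then have m01: "0 < m" "m < 1" and mean: "(\<integral>x. U m x \<partial>?P) = m"
    using f01[of m] by (auto simp: f_def)
  obtain c where c: "c > 0" "AE x in M. c \<le> r x \<and> r x \<le> 1 - c"
    using ratio by (auto simp: U_class_iff r_def)
  \<comment> \<open>\<open>U m x\<close> lies between \<open>r x\<close> and \<open>m\<close>, so it
    keeps from 0 and 1 at least the smaller of the margins of \<open>r\<close> and of
    \<open>m\<close>.\<close>
  define c' where "c' = min c (min m (1 - m))"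
  have "AE x in M. c' \<le> U m x \<and> U m x \<le> 1 - c'"
    using c(2) AE_space
  proof eventually_elim
    case (elim x)
    then show ?case
      using U(4,5)[of x m] unfolding c'_def by linarith
  qed
  moreover have "c' > 0"
    using c m01 by (simp add: c'_def)
  ultimately have "U m \<in> U_class M 0"
    using U_meas by (auto simp: U_class_iff)
  then show ?thesis
    using U(1,2,3)[of _ m] mean by (intro that[of "U m"]) (auto simp: r_def)
qed

end

subsection \<open>Scaling of the domain\<close>

lemma AE_lborel_scale:
  fixes c :: real
  assumes "c \<noteq> 0" and "AE y in (lborel :: 'a::euclidean_space measure). A y"
  shows "AE x in (lborel :: 'a measure). A (c *\<^sub>R x)"
proof -
  \<comment> \<open>Lebesgue measure is its own image under the scaling, up to the constant positive
    density \<open>\<bar>c\<bar> ^ DIM('a)\<close>, so the scaling preserves null sets.\<close>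
  have "AE y in density (distr (lborel :: 'a measure) borel (\<lambda>x. c *\<^sub>R x)) (\<lambda>_. \<bar>c\<bar> ^ DIM('a)). A y"
    using assms(2) lborel_affine[OF assms(1), of "0 :: 'a", unfolded add_0] by metis
  then have "AE y in distr (lborel :: 'a measure) borel (\<lambda>x. c *\<^sub>R x). A y"
    using assms(1) by (simp add: AE_density)
  then show ?thesis
    by (rule AE_distrD[rotated]) simp
qed

context
  fixes X :: "'a::euclidean_space set" and c :: real
  assumes X: "X \<in> sets borel" and c: "c \<noteq> 0"
begin

lemma borel_scale_image: "(*\<^sub>R) c ` X \<in> sets borel"
proof -
  have "(*\<^sub>R) c ` X = (\<lambda>y. y /\<^sub>R c) -` X"
    using c by (auto simp: image_iff intro!: bexI[of _ "_ /\<^sub>R c"])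
  also have "\<dots> \<in> sets borel"
    using X measurable_sets[of "\<lambda>y :: 'a. y /\<^sub>R c" borel borel X] by simp
  finally show ?thesis .
qed

lemma AE_lborel_on_scale:
  "(AE y in lborel_on ((*\<^sub>R) c ` X). A y) \<longleftrightarrow> (AE x in lborel_on X. A (c *\<^sub>R x))"
proof -
  have "(AE y in lborel_on ((*\<^sub>R) c ` X). A y) \<longleftrightarrow> (AE y in lborel. y \<in> (*\<^sub>R) c ` X \<longrightarrow> A y)"
    by (subst AE_restrict_space_iff) (auto simp: borel_scale_image)
  also have "\<dots> \<longleftrightarrow> (AE x in lborel. x \<in> X \<longrightarrow> A (c *\<^sub>R x))"
  proof
    assume "AE y in lborel. y \<in> (*\<^sub>R) c ` X \<longrightarrow> A y"
    from AE_lborel_scale[OF c this] show "AE x in lborel. x \<in> X \<longrightarrow> A (c *\<^sub>R x)"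
      by eventually_elim auto
  next
    assume "AE x in lborel. x \<in> X \<longrightarrow> A (c *\<^sub>R x)"
    \<comment> \<open>The converse is the same transfer applied to the inverse scaling.\<close>
    from AE_lborel_scale[OF _ this, of "1 / c"] c
    have "AE y in lborel. (1 / c) *\<^sub>R y \<in> X \<longrightarrow> A (c *\<^sub>R (1 / c) *\<^sub>R y)"
      by simp
    then show "AE y in lborel. y \<in> (*\<^sub>R) c ` X \<longrightarrow> A y"
      by eventually_elim (use c in auto)
  qed
  also have "\<dots> \<longleftrightarrow> (AE x in lborel_on X. A (c *\<^sub>R x))"
    by (subst AE_restrict_space_iff) (auto simp: X)
  finally show ?thesis .
qed

text \<open>The scaling is a measurable bijection with measurable inverse and respects null sets.
  Pulled back to X, all time slices therefore optimize over one and the same class.\<close>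

lemma U_class_scale:
  assumes "0 \<le> \<delta>"
  shows "f \<in> U_class (lborel_on ((*\<^sub>R) c ` X)) \<delta> \<longleftrightarrow> (\<lambda>x. f (c *\<^sub>R x)) \<in> U_class (lborel_on X) \<delta>"
proof -
  have "(\<lambda>x. c *\<^sub>R x) \<in> measurable (lborel_on X) (lborel_on ((*\<^sub>R) c ` X))"
    by (intro measurable_restrict_space3) auto
  then have 1: "(\<lambda>x. f (c *\<^sub>R x)) \<in> borel_measurable (lborel_on X)"
    if "f \<in> borel_measurable (lborel_on ((*\<^sub>R) c ` X))"
    using that by (rule measurable_compose)
  have inv: "(\<lambda>y. y /\<^sub>R c) \<in> measurable (lborel_on ((*\<^sub>R) c ` X)) (lborel_on X)"
    using c by (intro measurable_restrict_space3) auto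
  have 2: "f \<in> borel_measurable (lborel_on ((*\<^sub>R) c ` X))"
    if "(\<lambda>x. f (c *\<^sub>R x)) \<in> borel_measurable (lborel_on X)"
    using measurable_compose[OF inv that] c by simp
  show ?thesis
    unfolding U_class_iff[OF assms] AE_lborel_on_scale using 1 2 by blast
qed

end

section \<open>Assembling the time slices\<close>

theorem theorem1:
  fixes X :: "(real ^ 'd) set"
    and T lam \<delta> :: real
    and p0 q :: "real ^ 'd \<Rightarrow> real"
    and Z :: "'z measure"
    and G :: "'z \<Rightarrow> real ^ 'd"
    and s \<pi> :: "real \<Rightarrow> real"
  defines "P \<equiv> prob_with (lborel_on X) p0"
    and "R \<equiv> prob_with (lborel_on {0..T}) \<pi>"
  assumes X: "X = {x. \<forall>i. x $ i \<in> {0..1}} \<or> X = UNIV"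
    and T: "T > 0"
    and lam: "lam \<ge> 0"
    and p0: "pos_prob_density (lborel_on X) p0"
    and Z: "prob_space Z"
    and G: "distributed Z (lborel_on X) G (\<lambda>y. ennreal (q y))"
    and q: "pos_prob_density (lborel_on X) q"
    and p0_bounded: "p0 \<in> Linf (lborel_on X)"
    and delta: "\<delta> \<in> {0..<1/2}"
    and ratio: "(\<lambda>x. p0 x / (p0 x + q x)) \<in> U_class (lborel_on X) \<delta>"
    and s_pos: "\<forall>t\<in>{0..T}. s t > 0"
    and s_0: "s 0 = 1"
    and pi: "pos_prob_density (lborel_on {0..T}) \<pi>"
  shows "\<exists>D. optimal X R P Z G lam s D \<and>
    (\<forall>D'. optimal X R P Z G lam s D' \<longrightarrow>
       (AE t in lborel_on {0..T}. AE y in lborel_on ((*\<^sub>R) (s t) ` X). D' y t = D y t)) \<and>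
    (\<forall>t\<in>{0..T}. AE x in lborel_on X. D (s t *\<^sub>R x) t = D x 0) \<and>
    (\<forall>D'. optimal X R P Z G lam s D' \<longrightarrow>
       (AE t in lborel_on {0..T}. AE x in lborel_on X. D' (s t *\<^sub>R x) t = D x 0))"
proof -
  define Q where "Q = prob_with (lborel_on X) q"
  interpret R: prob_space R
    using pi by (simp add: pos_prob_density_def R_def)
  have "closed {x :: real ^ 'd. \<forall>i. x $ i \<in> {0..1}}"
    unfolding atLeastAtMost_iff
    by (intro closed_Collect_all closed_Collect_conj closed_Collect_le continuous_intros)
  then have X_borel: "X \<in> sets borel"
    using X by auto
  have space_R: "space R = {0..T}"
    by (simp add: R_def space_restrict_space)
  have distr_G: "distr Z (lborel_on X) G = Q"
    and G_meas: "G \<in> measurable Z (lborel_on X)"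
    using G by (auto simp: distributed_def Q_def)
  have U_slice: "(\<lambda>y. D y t) \<in> U_class (lborel_on ((*\<^sub>R) (s t) ` X)) 0
      \<longleftrightarrow> (\<lambda>x. D (s t *\<^sub>R x) t) \<in> U_class (lborel_on X) 0" if "t \<in> {0..T}" for D t
    using U_class_scale[OF X_borel, of "s t" 0 "\<lambda>y. D y t"] s_pos that by force
  have slice: "slice_objective P Z G lam s D t = payoff P Q lam (\<lambda>x. D (s t *\<^sub>R x) t)"
    if "(\<lambda>x. D (s t *\<^sub>R x) t) \<in> U_class (lborel_on X) 0" for D t
  proof -
    have [measurable]: "(\<lambda>x. D (s t *\<^sub>R x) t) \<in> borel_measurable (lborel_on X)"
      using that by (simp add: U_class_iff)
    \<comment> \<open>The latent expectation becomes an integral over X because Q is the law of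
      \<open>G z\<close>.\<close>
    have "(\<integral>x. ln (1 - D (s t *\<^sub>R x) t) \<partial>Q) = (\<integral>z. ln (1 - D (s t *\<^sub>R G z) t) \<partial>Z)"
      unfolding distr_G[symmetric] by (rule integral_distr[OF G_meas]) measurable
    then show ?thesis
      by (simp add: slice_objective_def payoff_def)
  qed
  have ratio0: "(\<lambda>x. p0 x / (p0 x + q x)) \<in> U_class (lborel_on X) 0"
    using ratio delta U_class_mono[of 0 \<delta> "lborel_on X"] by auto
  obtain u where u: "u \<in> U_class (lborel_on X) 0"
    "\<And>x. x \<in> space (lborel_on X) \<Longrightarrow> 0 < u x \<and> u x < 1"
    "\<And>x. x \<in> space (lborel_on X) \<Longrightarrow>
      stationary (2 * lam) (p0 x / (p0 x + q x)) (\<integral>x. u x \<partial>P) (u x) = 0"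
    using ex_payoff_stationary[OF p0 q lam ratio0] unfolding P_def by blast
  define J where "J = payoff P Q lam u"
  have J_nonpos: "J \<le> 0"
    unfolding J_def P_def Q_def by (rule payoff_nonpos[OF p0 q lam u(1)])
  have max: "payoff P Q lam v \<le> J" "payoff P Q lam v = J \<Longrightarrow> AE x in lborel_on X. v x = u x"
    if "v \<in> U_class (lborel_on X) 0" for v
    using payoff_stationary_max[OF p0 q lam u[unfolded P_def] that]
    by (auto simp: J_def P_def Q_def)
  \<comment> \<open>The single-slice maximizer \<open>u\<close> is transported to the scaled domain;
    the data scaling cancels, so every slice of \<open>D\<close> attains \<open>J\<close>.\<close>
  define D where "D = (\<lambda>y t. u (y /\<^sub>R s t))"
  have D: "(\<lambda>x. D (s t *\<^sub>R x) t) = u" if "t \<in> {0..T}" for t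
    using s_pos that by (force simp: D_def)
  have D_slice: "slice_objective P Z G lam s D t = J" if "t \<in> {0..T}" for t
    using slice[of D t] D[OF that] u(1) by (simp add: J_def)
  \<comment> \<open>\<open>s\<close> need not be measurable: the slice objective of \<open>D\<close>
    is constant on [0,T].\<close>
  have "slice_objective P Z G lam s D \<in> borel_measurable R"
    by (subst measurable_cong[where g = "\<lambda>_. J"]) (auto simp: space_R D_slice)
  then have D_feasible: "feasible X R P Z G lam s D"
    using U_slice D u(1) by (simp add: feasible_def space_R)
  have D_value: "objective R P Z G lam s D = ereal J"
    unfolding objective_def
    by (rule R.ext_expectation_const) (use D_slice J_nonpos in \<open>auto simp: space_R\<close>)
  have feas: "(\<lambda>x. D' (s t *\<^sub>R x) t) \<in> U_class (lborel_on X) 0"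
    "slice_objective P Z G lam s D' t \<le> J"
    if D': "feasible X R P Z G lam s D'" and t: "t \<in> {0..T}" for D' t
  proof -
    show U: "(\<lambda>x. D' (s t *\<^sub>R x) t) \<in> U_class (lborel_on X) 0"
      using D' t U_slice[OF t, of D'] by (simp add: feasible_def space_R)
    show "slice_objective P Z G lam s D' t \<le> J"
      unfolding slice[of D' t, OF U] by (rule max(1)[OF U])
  qed
  have value_le: "objective R P Z G lam s D' \<le> ereal J"
    if "feasible X R P Z G lam s D'" for D'
    unfolding objective_def
    by (rule R.ext_expectation_le)
      (use that feas(2)[OF that] J_nonpos in \<open>auto simp: feasible_def space_R\<close>)
  have D_opt: "optimal X R P Z G lam s D"
    using D_feasible value_le by (simp add: optimal_def D_value)
  have unique: "AE t in lborel_on {0..T}. AE x in lborel_on X. D' (s t *\<^sub>R x) t = u x"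
    if "optimal X R P Z G lam s D'" for D'
  proof -
    have D': "feasible X R P Z G lam s D'" and "objective R P Z G lam s D \<le> objective R P Z G lam s D'"
      using that D_feasible by (auto simp: optimal_def)
    then have "objective R P Z G lam s D' = ereal J"
      using value_le[OF D'] D_value by (intro antisym) simp_all
    then have "ext_expectation R (slice_objective P Z G lam s D') = ereal J"
      by (simp only: objective_def)
    \<comment> \<open>Every slice value is at most \<open>J\<close> while the average over t equals
      \<open>J\<close>, so almost every slice is itself optimal.\<close>
    then have "AE t in R. slice_objective P Z G lam s D' t = J"
      by (intro R.ext_expectation_le(2))
        (use D' feas(2)[OF D'] J_nonpos in \<open>auto simp: feasible_def space_R\<close>)
    then have "AE t in lborel_on {0..T}. slice_objective P Z G lam s D' t = J"
      unfolding R_def AE_prob_with[OF pi] .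
    then show ?thesis
      using AE_space
    proof eventually_elim
      case (elim t)
      then have t: "t \<in> {0..T}"
        by (simp add: space_restrict_space)
      show ?case
        using max(2)[OF feas(1)[OF D' t]] slice[of D' t, OF feas(1)[OF D' t]] elim by simp
    qed
  qed
  show ?thesis
  proof (intro exI[of _ D] conjI allI impI ballI)
    show "optimal X R P Z G lam s D"
      by (rule D_opt)
  next
    fix D' assume "optimal X R P Z G lam s D'"
    from unique[OF this] AE_space
    show "AE t in lborel_on {0..T}. AE y in lborel_on ((*\<^sub>R) (s t) ` X). D' y t = D y t"
    proof eventually_elim
      case (elim t)
      then have t: "t \<in> {0..T}"
        by (simp add: space_restrict_space)
      then have "s t \<noteq> 0"
        using s_pos by force
      with elim D[OF t] show ?case
        by (subst AE_lborel_on_scale[OF X_borel]) (auto simp: D_def)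
    qed
  next
    fix t assume "t \<in> {0..T}"
    then show "AE x in lborel_on X. D (s t *\<^sub>R x) t = D x 0"
      using s_pos s_0 by (force simp: D_def)
  next
    \<comment> \<open>The right-hand side is \<open>D x 0\<close> rather than \<open>D' x 0\<close>:
      the single time 0 is a null set, and there an optimal \<open>D'\<close> may differ from
      \<open>D\<close>.\<close>
    fix D' assume "optimal X R P Z G lam s D'"
    from unique[OF this]
    show "AE t in lborel_on {0..T}. AE x in lborel_on X. D' (s t *\<^sub>R x) t = D x 0"
      by (simp add: D_def s_0)
  qed
qed

end
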